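(* For every integer $k\ge 1$, $$\zeta(4k+1)=(2\pi)^{4k+1}\sum_{j=0}^k \frac{(-1)^{j+1}\, b_{jk}\, B_{2j}\, B_{4k+2-2j}}{(2j)!\,(4k+2-2j)!}-\frac{2a_k+4}{a_k}\,\mathcal{L}_{e^{-2\pi}}(-4k-1)+\frac{4}{a_k}\,\mathcal{L}_{e^{-4\pi}}(-4k-1),$$ where $$a_k=2^{4k+1}-(-1)^k2^{2k}-1,$$ $$b_{jk}=\frac{2^{2j-1}\left[1+(1+i)^{4k+1-2j}\right]-2^{4k+1-2j}\left[1+(1+i)^{2j-1}\right]}{a_k}.$$
   Context: For complex $q$ with $|q|<1$ and $s\in\mathbb{C}$, the Lambert series is $\mathcal{L}_q(s)=\sum_{n=1}^\infty \frac{n^s q^n}{1-q^n}$. $\zeta$ is the Riemann zeta function, $B_m$ is the $m$th Bernoulli number, and $i=\sqrt{-1}$ (the coefficients $b_{jk}$ are in general complex numbers). *)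

theory Defs
  imports "HOL-Analysis.Analysis"
    "HOL-Computational_Algebra.Computational_Algebra"
begin

(* n ranges over the positive integers, hence the shift by Suc; only meaningful for Re s > 1. *)
definition zeta_series :: "complex \<Rightarrow> complex" where
  "zeta_series s = (\<Sum>n. 1 / of_nat (Suc n) powr s)"

(* The second branch is the analytic continuation to the complex plane without 1. It is unique
   there by the identity theorem; the value at the pole s = 1 is left unspecified. *)
definition riemann_zeta :: "complex \<Rightarrow> complex" where
  "riemann_zeta s =
     (if 1 < Re s then zeta_series s
      else (SOME f. f holomorphic_on (- {1}) \<and> (\<forall>z. 1 < Re z \<longrightarrow> f z = zeta_series z)) s)"

(* Exponential generating function t / (exp t - 1), i.e. the convention B_1 = -1/2. *)
definition bernoulli :: "nat \<Rightarrow> real" where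
  "bernoulli m = fact m * fps_nth (fps_X / (fps_exp 1 - 1)) m"

(* The series converges for norm q < 1, for every complex s. *)
definition lambert_series :: "complex \<Rightarrow> complex \<Rightarrow> complex" where
  "lambert_series q s = (\<Sum>n. of_nat (Suc n) powr s * q ^ Suc n / (1 - q ^ Suc n))"

definition coeff_a :: "nat \<Rightarrow> real" where
  "coeff_a k = 2 ^ (4 * k + 1) - (- 1) ^ k * 2 ^ (2 * k) - 1"

(* Integer powers, since the exponent 2 * j - 1 is -1 for j = 0. *)
definition coeff_b :: "nat \<Rightarrow> nat \<Rightarrow> complex" where
  "coeff_b j k =
     (2 powi (2 * int j - 1) * (1 + (1 + \<i>) powi (4 * int k + 1 - 2 * int j))
      - 2 powi (4 * int k + 1 - 2 * int j) * (1 + (1 + \<i>) powi (2 * int j - 1)))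
     / of_real (coeff_a k)"

end

theory Submission
  imports Defs
begin

text \<open>
  Put \<open>S(x) = \<zeta>(2m+1) + 2 L(exp(-2\<pi>x))\<close>, which is the sum of \<open>coth(\<pi>nx) / n^(2m+1)\<close> over
  \<open>n \<ge> 1\<close>. The partial fractions of \<open>coth\<close> express it by the double series of
  \<open>1 / (n^(2m) (l^2 + n^2 x^2))\<close>. Decomposing the terms with respect to \<open>n^2\<close> leaves products of
  even zeta values and the same double series at \<open>1/x\<close> with \<open>l\<close> and \<open>n\<close> swapped; this is
  Ramanujan's formula relating \<open>S(x)\<close> and \<open>S(1/x)\<close>. Absolute convergence only needs \<open>Re (x^2) \<ge> 0\<close>,
  so that \<open>x = 2\<close> and \<open>x = 1 - i\<close> are admissible for \<open>m = 2k\<close>. With \<open>q = exp(-\<pi>)\<close>, they involve the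
  Lambert series at \<open>q^4, q\<close> and at \<open>q^2, -q\<close>, respectively. The values at \<open>q\<close> and \<open>-q\<close> are
  eliminated by the linear relation between the series at \<open>q, -q, q^2, q^4\<close>.
\<close>

section \<open>Unordered sums over product sets\<close>

text \<open>Summing a double family in either order requires summability over the product. The
  families below are all bounded by a product of two convergent series in one variable each.\<close>

lemma summable_on_Times_dominated:
  fixes f :: "'a \<times> 'b \<Rightarrow> 'c :: banach" and u :: "'a \<Rightarrow> real" and v :: "'b \<Rightarrow> real"
  assumes "u summable_on A" "v summable_on B"
    and "\<And>a. a \<in> A \<Longrightarrow> u a \<ge> 0" "\<And>b. b \<in> B \<Longrightarrow> v b \<ge> 0"
    and "\<And>a b. a \<in> A \<Longrightarrow> b \<in> B \<Longrightarrow> norm (f (a, b)) \<le> u a * v b"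
  shows "f summable_on (A \<times> B)"
proof -
  have "(\<lambda>(a, b). u a * v b) summable_on A \<times> B"
  proof (rule summable_on_SigmaI)
    show "((\<lambda>b. case (a, b) of (a, b) \<Rightarrow> u a * v b) has_sum u a * infsum v B) B" for a
      using has_sum_cmult_right[OF has_sum_infsum[OF assms(2)]] by simp
    show "(\<lambda>a. u a * infsum v B) summable_on A"
      by (rule summable_on_cmult_left[OF assms(1)])
  qed (use assms in auto)
  hence "(\<lambda>x. norm (f x)) summable_on (A \<times> B)"
    by (rule Infinite_Sum.abs_summable_on_comparison_test') (use assms in auto)
  thus ?thesis
    by (rule abs_summable_summable)
qed

lemma has_sum_Times_mult:
  fixes f :: "'a \<Rightarrow> 'c :: {banach, real_normed_field}" and g :: "'b \<Rightarrow> 'c"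
  assumes "(\<lambda>a. norm (f a)) summable_on A" "(\<lambda>b. norm (g b)) summable_on B" "(f has_sum S) A"
      "(g has_sum T) B"
  shows "((\<lambda>(a, b). f a * g b) has_sum S * T) (A \<times> B)"
proof (rule has_sum_SigmaI)
  show "((\<lambda>b. case (a, b) of (a, b) \<Rightarrow> f a * g b) has_sum f a * T) B" for a
    using has_sum_cmult_right[OF assms(4)] by simp
  show "((\<lambda>a. f a * T) has_sum S * T) A"
    by (rule has_sum_cmult_left[OF assms(3)])
  show "(\<lambda>(a, b). f a * g b) summable_on A \<times> B"
    by (rule summable_on_Times_dominated[OF assms(1,2)]) (auto simp: norm_mult)
qed

section \<open>Zeta values and Lambert series as unordered sums\<close>

lemma summable_on_inverse_Suc_power:
  assumes "n \<ge> 2"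
  shows "(\<lambda>l. 1 / real (Suc l) ^ n) summable_on UNIV"
proof -
  have "summable (\<lambda>l. inverse (real l ^ n))"
    using inverse_power_summable[of n, where 'a = real] assms by simp
  hence "summable (\<lambda>l. 1 / real (Suc l) ^ n)"
    by (subst (asm) summable_Suc_iff[symmetric]) (simp add: divide_inverse del: of_nat_Suc)
  thus ?thesis
    by (subst summable_on_UNIV_nonneg_real_iff) auto
qed

text \<open>The branch \<open>1 < Re s\<close> of \<open>riemann_zeta\<close> applies. All zeta
  values in the proof are taken at integers from 2 on, so each of them is an absolutely convergent
  sum.\<close>

lemma riemann_zeta_has_sum:
  assumes "n \<ge> 2"
  shows "((\<lambda>l. 1 / of_nat (Suc l) ^ n) has_sum riemann_zeta (of_nat n)) UNIV"
proof -
  have "summable (\<lambda>l. norm (1 / of_nat (Suc l) ^ n :: complex))"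
    using summable_on_imp_summable[OF summable_on_inverse_Suc_power[OF assms]]
    by (simp add: norm_divide norm_power del: of_nat_Suc)
  moreover have "(\<Sum>l. 1 / of_nat (Suc l) ^ n) = riemann_zeta (of_nat n)"
  proof -
    have "of_nat (Suc l) powr (of_nat n :: complex) = of_nat (Suc l) ^ n" for l
      using assms by (subst powr_nat') auto
    thus ?thesis
      using assms by (simp add: riemann_zeta_def zeta_series_def del: of_nat_Suc)
  qed
  ultimately show ?thesis
    using norm_summable_imp_has_sum summable_norm_cancel summable_sums by metis
qed

lemma powr_neg_of_nat: "of_nat (Suc n) powr (- of_nat p :: complex) = 1 / of_nat (Suc n) ^ p"
  by (simp add: powr_minus powr_nat' divide_inverse del: of_nat_Suc)

text \<open>The denominators stay away from 0, since |1 - q^n| >= 1 - |q| for n >= 1. Hence a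
  geometric series dominates.\<close>

lemma lambert_series_has_sum:
  assumes "norm q < 1"
  shows "((\<lambda>n. q ^ Suc n / (1 - q ^ Suc n) / of_nat (Suc n) ^ p) has_sum
      lambert_series q (- of_nat p)) UNIV"
proof (rule norm_summable_imp_has_sum)
  have bound: "norm (q ^ Suc n / (1 - q ^ Suc n) / of_nat (Suc n) ^ p) \<le>
      norm q ^ Suc n / (1 - norm q)" for n
  proof -
    have "norm q ^ Suc n \<le> norm q"
      using assms by (simp add: mult_left_le power_le_one)
    moreover have "1 - norm q ^ Suc n \<le> norm (1 - q ^ Suc n)"
      using norm_triangle_ineq2[of 1 "q ^ Suc n"] by (simp add: norm_power norm_mult)
    ultimately have "1 - norm q \<le> norm (1 - q ^ Suc n)" by linarith
    hence 1: "norm q ^ Suc n / norm (1 - q ^ Suc n) \<le> norm q ^ Suc n / (1 - norm q)"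
      using assms by (intro divide_left_mono mult_pos_pos) auto
    have 2: "1 \<le> real (Suc n) ^ p"
      by (simp add: one_le_power)
    have "norm q ^ Suc n / norm (1 - q ^ Suc n) / real (Suc n) ^ p \<le>
        norm q ^ Suc n / (1 - norm q) / 1"
      by (intro frac_le 1 2) (use assms in auto)
    thus ?thesis by (simp add: norm_divide norm_mult norm_power del: of_nat_Suc power_Suc)
  qed
  have "summable (\<lambda>n. norm q ^ Suc n / (1 - norm q))"
    using assms by (intro summable_divide) (subst summable_Suc_iff, auto)
  thus *: "summable (\<lambda>n. norm (q ^ Suc n / (1 - q ^ Suc n) / of_nat (Suc n) ^ p))"
    by (rule summable_comparison_test'[where N = 0]) (use bound in auto)
  have "(\<lambda>n. q ^ Suc n / (1 - q ^ Suc n) / of_nat (Suc n) ^ p) sums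
      (\<Sum>n. q ^ Suc n / (1 - q ^ Suc n) / of_nat (Suc n) ^ p)"
    by (rule summable_sums[OF summable_norm_cancel[OF *]])
  also have "(\<Sum>n. q ^ Suc n / (1 - q ^ Suc n) / of_nat (Suc n) ^ p) = lambert_series q (- of_nat p)"
    unfolding lambert_series_def powr_neg_of_nat by (simp add: mult.commute)
  finally show "(\<lambda>n. q ^ Suc n / (1 - q ^ Suc n) / of_nat (Suc n) ^ p) sums
      lambert_series q (- of_nat p)" .
qed

section \<open>Partial fractions of cot and coth\<close>

text \<open>This is the logarithmic derivative of the reflection formula rGamma(z) rGamma(1 - z) =
  sin(pi z) / pi: both sides are differentiated at z, and the result is divided by the formula
  itself. For z outside the integers neither factor vanishes.\<close>

lemma Digamma_reflection:
  fixes z :: complex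
  assumes "z \<notin> \<int>"
  shows "Digamma (1 - z) - Digamma z = pi * cot (pi * z)"
proof -
  have nz: "z \<notin> \<int>\<^sub>\<le>\<^sub>0" "1 - z \<notin> \<int>\<^sub>\<le>\<^sub>0"
    using assms Ints_diff[of 1 "1 - z"] nonpos_Ints_subset_Ints by auto
  have "sin (pi * z) / pi = rGamma z * rGamma (1 - z)"
    by (simp add: rGamma_reflection_complex)
  moreover have "rGamma z \<noteq> 0" "rGamma (1 - z) \<noteq> 0"
    using nz by (auto simp: rGamma_eq_zero_iff)
  ultimately have sin_nz: "sin (pi * z) \<noteq> 0"
    by auto
  have "((\<lambda>z. rGamma z * rGamma (1 - z)) has_field_derivative rGamma z * rGamma (1 - z)
      * (Digamma (1 - z) - Digamma z)) (at z)"
  proof -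
    have "((\<lambda>z. rGamma (1 - z)) has_field_derivative
        - rGamma (1 - z) * Digamma (1 - z) * (- 1)) (at z)"
      by (rule DERIV_chain2[where g = "\<lambda>z. 1
          - z", OF has_field_derivative_rGamma_no_nonpos_int[OF nz(2)]])
         (auto intro!: derivative_eq_intros)
    from DERIV_mult[OF has_field_derivative_rGamma_no_nonpos_int[OF nz(1)] this]
    show ?thesis
      by (simp add: algebra_simps)
  qed
  moreover have "((\<lambda>z. sin (of_real pi * z) / of_real pi) has_field_derivative cos (pi * z)) (at z)"
    by (auto intro!: derivative_eq_intros)
  ultimately have "rGamma z * rGamma (1 - z) * (Digamma (1 - z) - Digamma z) = cos (pi * z)"
    by (intro DERIV_unique) (auto simp: rGamma_reflection_complex)
  thus ?thesis
    using sin_nz by (simp add: rGamma_reflection_complex cot_def field_simps)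
qed

text \<open>Each term splits as 1/(l + z) - 1/(l - z) with l >= 1, so the series is the difference
  of the Digamma series at 1 - z and 1 + z. Shifting 1 + z to z produces the summand -1/z, and
  reflection gives the cotangent.\<close>

lemma cot_partial_fractions:
  fixes z :: complex
  assumes "z \<notin> \<int>"
  shows "(\<lambda>l. - 2 * z / (of_nat (Suc l) ^ 2 - z ^ 2)) sums (pi * cot (pi * z) - 1 / z)"
proof -
  have nz: "z \<noteq> 0" "1 - z \<noteq> 0" "1 + z \<noteq> 0"
    using assms Ints_diff[of "1 + z" 1] by (auto simp: add_eq_0_iff)
  have nz': "of_nat (Suc l) - z \<noteq> 0" "of_nat (Suc l) + z \<noteq> 0" for l
    using assms by (auto simp: add_eq_0_iff simp del: of_nat_Suc)
  have "(\<lambda>l. (inverse (of_nat (Suc l)) - inverse ((1 - z) + of_nat l))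
      - (inverse (of_nat (Suc l)) - inverse ((1 + z) + of_nat l))) sums
      ((Digamma (1 - z) + euler_mascheroni) - (Digamma (1 + z) + euler_mascheroni))"
    unfolding Digamma_def diff_add_cancel using nz
    by (intro sums_diff summable_sums summable_Digamma) auto
  also have "(\<lambda>l. (inverse (of_nat (Suc l)) - inverse ((1 - z) + of_nat l))
      - (inverse (of_nat (Suc l)) - inverse ((1 + z) + of_nat l))) =
      (\<lambda>l. - 2 * z / (of_nat (Suc l) ^ 2 - z ^ 2))"
  proof
    fix l
    have *: "(1 - z) + of_nat l = of_nat (Suc l) - z" "(1 + z) + of_nat l = of_nat (Suc l) + z"
      by simp_all
    have **: "(of_nat (Suc l) :: complex) ^ 2 - z ^ 2 = (of_nat (Suc l) - z) * (of_nat (Suc l) + z)"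
      by (simp add: algebra_simps power2_eq_square)
    show "(inverse (of_nat (Suc l)) - inverse ((1 - z) + of_nat l))
        - (inverse (of_nat (Suc l)) - inverse ((1 + z) + of_nat l)) =
        - 2 * z / (of_nat (Suc l) ^ 2 - z ^ 2)"
      unfolding * ** using nz'[of l]
          by (simp add: divide_simps del: of_nat_Suc) (simp add: algebra_simps)
  qed
  also have "(Digamma (1 - z) + euler_mascheroni) - (Digamma (1 + z) + euler_mascheroni) =
      pi * cot (pi * z) - 1 / z"
    using Digamma_plus1[OF nz(1)] Digamma_reflection[OF assms] by (simp add: add.commute)
  finally show ?thesis .
qed

text \<open>Substitute z = -i w in the cotangent expansion. The factor 1 + 2 / (exp(2 pi w) - 1) is
  coth(pi w), written in the form from which Lambert terms can be read off. The hypothesis on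
  \<open>Re w\<close> keeps z off the real axis and hence off the poles.\<close>

lemma coth_partial_fractions:
  fixes w :: complex
  assumes "Re w \<noteq> 0"
  shows "(\<lambda>l. 2 * w / (of_nat (Suc l) ^ 2 + w ^ 2)) sums
      (pi * (1 + 2 / (exp (2 * pi * w) - 1)) - 1 / w)"
proof -
  define z where "z = - \<i> * w"
  have "w = \<i> * z" by (simp add: z_def)
  have "z \<notin> \<int>"
    using assms by (auto simp: z_def elim!: Ints_cases simp: complex_eq_iff)
  hence "(\<lambda>l. - \<i> * (- 2 * z / (of_nat (Suc l) ^ 2 - z ^ 2))) sums
      (- \<i> * (pi * cot (pi * z) - 1 / z))"
    by (intro sums_mult cot_partial_fractions)
  also have "(\<lambda>l. - \<i> * (- 2 * z / (of_nat (Suc l) ^ 2 - z ^ 2))) =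
      (\<lambda>l. 2 * w / (of_nat (Suc l) ^ 2 + w ^ 2))"
    by (simp add: \<open>w = _\<close> power_mult_distrib mult.left_commute)
  also have "- \<i> * (pi * cot (pi * z) - 1 / z) = pi * (1 + 2 / (exp (2 * pi * w) - 1)) - 1 / w"
  proof -
    define E where "E = exp (pi * w)"
    have "E * E = exp (2 * pi * w)"
      by (simp add: E_def exp_add [symmetric] mult_ac)
    have "exp (\<i> * (pi * z)) = E" "exp (- (\<i> * (pi * z))) = 1 / E"
      by (simp_all add: E_def z_def exp_minus field_simps)
    hence "cot (pi * z) = ((E + 1 / E) / 2) / ((E - 1 / E) / (2 * \<i>))"
      by (simp add: cot_def sin_exp_eq cos_exp_eq)
    moreover have "E * E \<noteq> 1"
      using assms by (auto simp: \<open>E * E = _\<close> exp_eq_1)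
    moreover have "E \<noteq> 0" by (simp add: E_def)
    moreover from \<open>E \<noteq> 0\<close> have "E + 1 / E = (E * E + 1) / E" "E - 1 / E = (E * E - 1) / E"
      by (simp_all add: field_simps)
    moreover have "(a / E / 2) / (b / E / (2 * \<i>)) = \<i> * a / b" if "E \<noteq> 0" "b \<noteq> 0" for a b
      using that by (simp add: field_simps)
    ultimately have "cot (pi * z) = \<i> * (E * E + 1) / (E * E - 1)"
      by simp
    also have "\<dots> = \<i> * (1 + 2 / (E * E - 1))"
      using \<open>E * E \<noteq> 1\<close> by (simp add: field_simps)
    finally show ?thesis
      using assms unfolding \<open>E * E = _\<close> by (auto simp: z_def algebra_simps)
  qed
  finally show ?thesis .
qed

section \<open>A linear relation between the Lambert series at q, -q, q^2 and q^4\<close>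

text \<open>Split by the parity of n. At even n the terms for q and -q agree and reindex to the
  series at q^2. At odd n put Q = q^n: then Q/(1 - Q) - Q/(1 + Q) = 2 Q^2/(1 - Q^2) gives twice the
  odd terms of the series at q^2, that is, the whole series minus its even terms, and those reindex
  to q^4. Each reindexing n = 2n' costs a factor 2^(-p).\<close>

lemma lambert_series_add_minus:
  assumes "norm q < 1"
  shows "lambert_series q (- of_nat p) + lambert_series (- q) (- of_nat p) =
      2 * (1 + 1 / 2 ^ p) * lambert_series (q ^ 2) (- of_nat p)
      - 2 / 2 ^ p * lambert_series (q ^ 4) (- of_nat p)"
proof -
  define f where "f = (\<lambda>q n. q ^ n / (1 - q ^ n) / of_nat n ^ p :: complex)"
  have pos: "range Suc = {0<..}"
    by (auto simp: image_iff gr0_conv_Suc)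
  have f_sum: "(f q has_sum lambert_series q (- of_nat p)) {0<..}" if "norm q < 1" for q
    using lambert_series_has_sum[OF that, of p] has_sum_reindex[of Suc UNIV "f q"]
    by (simp add: pos f_def o_def)
  define A where "A = (\<lambda>n::nat. 2 * n) ` {0<..}"
  have evens: "A = {n. n > 0 \<and> even n}"
    by (auto simp: A_def elim!: evenE)
  have q2: "norm (q ^ 2) < 1" and q4: "norm (q ^ 4) < 1"
    using assms by (auto simp: norm_power power_less_one_iff)
  have inj: "inj_on (\<lambda>n::nat. 2 * n) {0<..}"
    by (auto simp: inj_on_def)
  have nz: "q ^ n \<noteq> 1" if "n > 0" "norm q < 1" for n and q :: complex
  proof
    assume "q ^ n = 1"
    hence "norm q ^ n = 1"
      by (simp add: norm_power [symmetric])
    thus False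
      using that power_less_one_iff[of "norm q" n] by simp
  qed
  have "((\<lambda>n. 2 / 2 ^ p * f (q ^ 2) n) has_sum
      2 / 2 ^ p * lambert_series (q ^ 2) (- of_nat p)) {0<..}"
    by (intro has_sum_cmult_right f_sum q2)
  also have "(\<lambda>n. 2 / 2 ^ p * f (q ^ 2) n) = (\<lambda>n. f q n + f (- q) n) \<circ> (\<lambda>n. 2 * n)"
  proof
    fix n
    have "(q ^ 2) ^ n = q ^ (2 * n)" "(- q) ^ (2 * n) = q ^ (2 * n)"
      by (simp_all add: power_mult)
    thus "2 / 2 ^ p * f (q ^ 2) n = ((\<lambda>n. f q n + f (- q) n) \<circ> (\<lambda>n. 2 * n)) n"
      by (simp add: f_def power_mult_distrib)
  qed
  finally have even_sum: "((\<lambda>n. f q n + f (- q) n) has_sum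
      2 / 2 ^ p * lambert_series (q ^ 2) (- of_nat p)) A"
    unfolding A_def by (subst has_sum_reindex[OF inj])
  have "((\<lambda>n. f (q ^ 4) n / 2 ^ p) has_sum lambert_series (q ^ 4) (- of_nat p) / 2 ^ p) {0<..}"
    by (intro has_sum_divide_const f_sum q4)
  also have "(\<lambda>n. f (q ^ 4) n / 2 ^ p) = f (q ^ 2) \<circ> (\<lambda>n. 2 * n)"
    by (auto simp: f_def fun_eq_iff power_mult [symmetric] power_mult_distrib)
  finally have "(f (q ^ 2) has_sum lambert_series (q ^ 4) (- of_nat p) / 2 ^ p) A"
    unfolding A_def by (subst has_sum_reindex[OF inj])
  hence "((\<lambda>n. 2 * f (q ^ 2) n) has_sum
      2 * (lambert_series (q ^ 2) (- of_nat p)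
      - lambert_series (q ^ 4) (- of_nat p) / 2 ^ p)) ({0<..} - A)"
    by (intro has_sum_cmult_right has_sum_Diff f_sum q2) (auto simp: A_def)
  also have "?this \<longleftrightarrow> ((\<lambda>n. f q n + f (- q) n) has_sum
      2 * (lambert_series (q ^ 2) (- of_nat p)
      - lambert_series (q ^ 4) (- of_nat p) / 2 ^ p)) ({0<..} - A)"
  proof (rule has_sum_cong)
    fix n assume "n \<in> {0<..} - A"
    hence n: "odd n" "n > 0" by (auto simp: evens)
    have "(q ^ 2) ^ n = q ^ n * q ^ n"
      by (simp add: power_mult [symmetric] power_add [symmetric] mult_2)
    have "2 * (Q * Q / (1 - Q * Q)) = Q / (1 - Q) - Q / (1 + Q)" if "Q \<noteq> 1" "- Q \<noteq> 1"
        for Q :: complex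
    proof -
      have "1 - Q * Q = (1 - Q) * (1 + Q)" "1 - Q \<noteq> 0" "1 + Q \<noteq> 0"
        using that by (auto simp: algebra_simps add_eq_0_iff)
      thus ?thesis
        by (simp add: divide_simps) (simp add: algebra_simps)
    qed
    from this[of "q ^ n"] have "2 * (q ^ n * q ^ n / (1 - q ^ n * q ^ n)) / of_nat n ^ p =
        (q ^ n / (1 - q ^ n) - q ^ n / (1 + q ^ n)) / of_nat n ^ p"
      using n nz[of n q] nz[of n "- q"] assms by simp
    thus "2 * f (q ^ 2) n = f q n + f (- q) n"
      using n \<open>(q ^ 2) ^ n = q ^ n * q ^ n\<close> by (simp add: f_def diff_divide_distrib)
  qed
  finally have odd_sum: "((\<lambda>n. f q n + f (- q) n) has_sum
      2 * (lambert_series (q ^ 2) (- of_nat p)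
      - lambert_series (q ^ 4) (- of_nat p) / 2 ^ p)) ({0<..} - A)" .
  have "A \<union> ({0<..} - A) = {0<..}"
    by (auto simp: A_def)
  with has_sum_Un_disjoint[OF even_sum odd_sum]
  have sum1: "((\<lambda>n. f q n + f (- q) n) has_sum
      2 / 2 ^ p * lambert_series (q ^ 2) (- of_nat p)
      + 2 * (lambert_series (q ^ 2) (- of_nat p)
      - lambert_series (q ^ 4) (- of_nat p) / 2 ^ p)) {0<..}"
    by simp
  have "((\<lambda>n. f q n + f (- q) n) has_sum
      lambert_series q (- of_nat p) + lambert_series (- q) (- of_nat p)) {0<..}"
    by (intro has_sum_add; rule f_sum) (use assms in auto)
  from has_sum_unique[OF this sum1] show ?thesis
    by (simp add: ring_distribs)
qed

section \<open>The double series and its reciprocity\<close>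

lemma has_sum_finite_sum:
  fixes f :: "'a \<Rightarrow> 'b \<Rightarrow> 'c :: topological_comm_monoid_add"
  assumes "finite I" "\<And>i. i \<in> I \<Longrightarrow> (f i has_sum S i) A"
  shows "((\<lambda>x. \<Sum>i\<in>I. f i x) has_sum (\<Sum>i\<in>I. S i)) A"
  using assms by (induction I rule: finite_induct) (auto intro: has_sum_add)

lemma has_sum_subtract:
  fixes f g :: "'a \<Rightarrow> 'b :: topological_ab_group_add"
  assumes "(f has_sum S) A" "(g has_sum T) A"
  shows "((\<lambda>x. f x - g x) has_sum (S - T)) A"
  using tendsto_diff assms unfolding has_sum_def sum_subtractf by blast

text \<open>The partial fraction expansions yield \<open>sums\<close>, whereas iterated summation
  uses \<open>has_sum\<close>. Once unordered summability is known, the two values coincide.\<close>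

lemma sums_imp_has_sum:
  fixes f :: "nat \<Rightarrow> 'a :: {topological_comm_monoid_add, t2_space}"
  assumes "f summable_on UNIV" "f sums S"
  shows "(f has_sum S) UNIV"
  using sums_unique2[OF has_sum_imp_sums[OF has_sum_infsum[OF assms(1)]] assms(2)] has_sum_infsum[OF assms(1)]
  by simp

text \<open>Iterate 1/(t (L + t y)) = 1/(L t) - y/(L (L + t y)): every step trades one factor t in
  the remainder for a factor L. It is used with t = n^2, L = l^2, y = x^2.\<close>

lemma partial_fractions_power:
  fixes t L y :: complex
  assumes "t \<noteq> 0" "L \<noteq> 0" "L + t * y \<noteq> 0"
  shows "1 / (t ^ m * (L + t * y)) =
      (\<Sum>j<m. (- y) ^ j * (1 / L ^ (j + 1)) * (1 / t ^ (m - j)))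
      + (- y) ^ m * (1 / (L ^ m * (L + t * y)))"
proof (induction m)
  case (Suc m)
  have "1 / (t ^ Suc m * (L + t * y)) = 1 / t * (1 / (t ^ m * (L + t * y)))"
    by simp
  also have "\<dots> = (\<Sum>j<m. (- y) ^ j * (1 / L ^ (j + 1)) * (1 / t ^ (m - j)) * (1 / t))
      + (- y) ^ m / L ^ m * (1 / (t * (L + t * y)))"
    unfolding Suc.IH by (simp add: ring_distribs sum_distrib_left mult_ac)
  also have "1 / (t * (L + t * y)) = 1 / (L * t) - y / (L * (L + t * y))"
    using assms by (simp add: divide_simps)
  also have "(\<Sum>j<m. (- y) ^ j * (1 / L ^ (j + 1)) * (1 / t ^ (m - j)) * (1 / t)) =
      (\<Sum>j<m. (- y) ^ j * (1 / L ^ (j + 1)) * (1 / t ^ (Suc m - j)))"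
    by (intro sum.cong) (simp_all add: Suc_diff_le)
  finally show ?case
    by (simp add: algebra_simps)
qed auto

text \<open>Since Re(x^2) >= 0, the real part of l^2 + n^2 x^2 is at least l^2, so the terms are
  bounded by n^(-2m) l^(-2). The boundary case Re(x^2) = 0 is included, as x = 1 - i
  requires.\<close>

lemma summable_on_double_series:
  fixes x :: complex
  assumes "Re (x ^ 2) \<ge> 0" "m \<ge> 1"
  shows "(\<lambda>(n, l). 1 / (of_nat (Suc n) ^ (2 * m)
      * (of_nat (Suc l) ^ 2 + of_nat (Suc n) ^ 2 * x ^ 2))) summable_on UNIV \<times> UNIV"
proof (rule summable_on_Times_dominated)
  show "(\<lambda>n. 1 / real (Suc n) ^ (2 * m)) summable_on UNIV"
      "(\<lambda>l. 1 / real (Suc l) ^ 2) summable_on UNIV"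
    using assms by (intro summable_on_inverse_Suc_power; simp)+
  fix n l :: nat
  have "real (Suc l) ^ 2 \<le> norm (of_nat (Suc l) ^ 2 + of_nat (Suc n) ^ 2 * x ^ 2)"
  proof -
    have "real (Suc l) ^ 2 \<le> Re (of_real (real (Suc l) ^ 2) + of_real (real (Suc n) ^ 2) * x ^ 2)"
      using assms(1) by (simp only: plus_complex.sel times_complex.sel Re_complex_of_real Im_complex_of_real) simp
    also have "\<dots> \<le> norm (of_real (real (Suc l) ^ 2) + of_real (real (Suc n) ^ 2) * x ^ 2)"
      by (rule complex_Re_le_cmod)
    finally show ?thesis by simp
  qed
  hence "1 / norm (of_nat (Suc l) ^ 2 + of_nat (Suc n) ^ 2 * x ^ 2) \<le> 1 / real (Suc l) ^ 2"
    by (intro divide_left_mono mult_pos_pos) (auto intro: less_le_trans[rotated])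
  hence "1 / real (Suc n) ^ (2 * m)
      * (1 / norm (of_nat (Suc l) ^ 2 + of_nat (Suc n) ^ 2 * x ^ 2)) \<le>
      1 / real (Suc n) ^ (2 * m) * (1 / real (Suc l) ^ 2)"
    by (intro mult_left_mono) auto
  thus "norm (case (n, l) of (n, l) \<Rightarrow> 1
      / (of_nat (Suc n) ^ (2 * m) * (of_nat (Suc l) ^ 2 + of_nat (Suc n) ^ 2 * x ^ 2))) \<le>
      1 / real (Suc n) ^ (2 * m) * (1 / real (Suc l) ^ 2)"
    by (simp add: norm_divide norm_mult norm_power del: of_nat_Suc)
qed auto

text \<open>With q = exp(-2 pi x), q^n / (1 - q^n) = 1 / (exp(2 pi n x) - 1). Adding the zeta terms
  turns the summand into coth(pi n x) / n^(2m+1).\<close>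

lemma lambert_series_exp_has_sum:
  fixes x :: complex
  assumes "Re x > 0" "m \<ge> 1"
  shows "((\<lambda>n. 1 / of_nat (Suc n) ^ (2 * m + 1)
      * (1 + 2 / (exp (2 * pi * (of_nat (Suc n) * x)) - 1))) has_sum
      (riemann_zeta (of_nat (2 * m + 1))
      + 2 * lambert_series (exp (- 2 * pi * x)) (- of_nat (2 * m + 1)))) UNIV"
proof -
  define q where "q = exp (- 2 * pi * x)"
  have "norm q < 1"
    using assms by (simp add: q_def norm_exp_eq_Re)
  hence sums: "((\<lambda>n. 1 / of_nat (Suc n) ^ (2 * m + 1)
      + 2 * (q ^ Suc n / (1 - q ^ Suc n) / of_nat (Suc n) ^ (2 * m + 1))) has_sum
      (riemann_zeta (of_nat (2 * m + 1)) + 2 * lambert_series q (- of_nat (2 * m + 1)))) UNIV"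
    using assms by (intro has_sum_add has_sum_cmult_right riemann_zeta_has_sum
        lambert_series_has_sum) auto
  have q: "q ^ Suc n / (1 - q ^ Suc n) = 1 / (exp (2 * pi * (of_nat (Suc n) * x)) - 1)" for n
  proof -
    have "q ^ Suc n = 1 / exp (2 * pi * (of_nat (Suc n) * x))"
      unfolding q_def exp_of_nat_mult [symmetric]
      by (simp add: exp_minus divide_inverse mult_ac del: of_nat_Suc)
    moreover have "1 / E / (1 - 1 / E) = 1 / (E - 1)" if "E \<noteq> 0" for E :: complex
      using that by (cases "E = 1") (auto simp: field_simps)
    ultimately show ?thesis
      by simp
  qed
  have "1 / of_nat (Suc n) ^ (2 * m + 1)
      + 2 * (q ^ Suc n / (1 - q ^ Suc n) / of_nat (Suc n) ^ (2 * m + 1)) =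
      1 / of_nat (Suc n) ^ (2 * m + 1) * (1 + 2 / (exp (2 * pi * (of_nat (Suc n) * x)) - 1))" for n
    unfolding q by (simp add: ring_distribs del: of_nat_Suc power_Suc)
  with sums show ?thesis
    by (simp only: q_def)
qed

text \<open>For fixed n the sum over l is the expansion of coth at w = n x. Its term -1/w, summed
  over n, accounts for the value zeta(2m+2).\<close>

lemma lambert_series_eq_double_series:
  fixes x :: complex
  assumes "Re x > 0" "Re (x ^ 2) \<ge> 0" "m \<ge> 1"
  defines "D \<equiv> (\<Sum>\<^sub>\<infinity>(n, l)\<in>UNIV \<times> UNIV. 1
      / (of_nat (Suc n) ^ (2 * m) * (of_nat (Suc l) ^ 2 + of_nat (Suc n) ^ 2 * x ^ 2)))"
  shows "pi * (riemann_zeta (of_nat (2 * m + 1))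
      + 2 * lambert_series (exp (- 2 * pi * x)) (- of_nat (2 * m + 1))) =
      riemann_zeta (of_nat (2 * m + 2)) / x + 2 * x * D"
proof -
  let ?f = "\<lambda>(n, l). 1 / (of_nat (Suc n) ^ (2 * m)
      * (of_nat (Suc l) ^ 2 + of_nat (Suc n) ^ 2 * x ^ 2))"
  let ?c = "\<lambda>n. pi * (1 + 2 / (exp (2 * pi * (of_nat (Suc n) * x)) - 1))"
  have [simp]: "x \<noteq> 0" using assms by auto
  have f: "(?f has_sum D) (UNIV \<times> UNIV)"
    unfolding D_def by (intro has_sum_infsum summable_on_double_series assms)
  have row: "((\<lambda>l. ?f (n, l)) has_sum
      1 / of_nat (Suc n) ^ (2 * m + 1) / (2 * x) * ?c n
      - 1 / of_nat (Suc n) ^ (2 * m + 2) / (2 * x ^ 2)) UNIV" for n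
  proof -
    let ?w = "of_nat (Suc n) * x"
    have "(\<lambda>l. ?f (n, l)) summable_on UNIV"
      using summable_on_SigmaD1[OF summable_on_double_series[OF assms(2,3)], of n] by simp
    moreover have "(\<lambda>l. ?f (n, l)) sums (1 / of_nat (Suc n) ^ (2 * m) / (2 * ?w) * (?c n - 1 / ?w))"
    proof -
      have "Re ?w \<noteq> 0"
        using assms by (simp del: of_nat_Suc)
      hence "(\<lambda>l. 1 / of_nat (Suc n) ^ (2 * m) / (2 * ?w)
          * (2 * ?w / (of_nat (Suc l) ^ 2 + ?w ^ 2))) sums
          (1 / of_nat (Suc n) ^ (2 * m) / (2 * ?w) * (?c n - 1 / ?w))"
        by (intro sums_mult coth_partial_fractions)
      thus ?thesis
        by (simp add: power_mult_distrib del: of_nat_Suc)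
    qed
    ultimately have "((\<lambda>l. ?f (n, l)) has_sum
        (1 / of_nat (Suc n) ^ (2 * m) / (2 * ?w) * (?c n - 1 / ?w))) UNIV"
      by (rule sums_imp_has_sum)
    also have "1 / of_nat (Suc n) ^ (2 * m) / (2 * ?w) * (?c n - 1 / ?w) =
        1 / of_nat (Suc n) ^ (2 * m + 1) / (2 * x) * ?c n
        - 1 / of_nat (Suc n) ^ (2 * m + 2) / (2 * x ^ 2)"
      by (simp add: right_diff_distrib power2_eq_square mult_ac del: of_nat_Suc)
    finally show ?thesis .
  qed
  have "((\<lambda>n. 1 / of_nat (Suc n) ^ (2 * m + 1) / (2 * x) * ?c n
      - 1 / of_nat (Suc n) ^ (2 * m + 2) / (2 * x ^ 2)) has_sum D) UNIV"
    by (rule has_sum_SigmaD[OF f row])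
  moreover have "((\<lambda>n. pi / (2 * x)
      * (1 / of_nat (Suc n) ^ (2 * m + 1) * (1 + 2 / (exp (2 * pi * (of_nat (Suc n) * x)) - 1)))
      - 1 / (2 * x ^ 2) * (1 / of_nat (Suc n) ^ (2 * m + 2))) has_sum
      (pi / (2 * x) * (riemann_zeta (of_nat (2 * m + 1))
      + 2 * lambert_series (exp (- 2 * pi * x)) (- of_nat (2 * m + 1)))
      - 1 / (2 * x ^ 2) * riemann_zeta (of_nat (2 * m + 2)))) UNIV"
    using assms by (intro has_sum_subtract has_sum_cmult_right lambert_series_exp_has_sum
        riemann_zeta_has_sum) auto
  ultimately have D_eq: "D = pi / (2 * x)
      * (riemann_zeta (of_nat (2 * m + 1))
      + 2 * lambert_series (exp (- 2 * pi * x)) (- of_nat (2 * m + 1)))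
      - 1 / (2 * x ^ 2) * riemann_zeta (of_nat (2 * m + 2))"
    by (intro has_sum_unique) (auto simp: mult_ac)
  have "pi * Y = Z / x + 2 * x * (pi / (2 * x) * Y - 1 / (2 * x ^ 2) * Z)" for Y Z :: complex
    by (simp add: right_diff_distrib power2_eq_square)
  thus ?thesis
    unfolding D_eq .
qed

text \<open>Decompose every term by \<open>partial_fractions_power\<close>. The first m summands
  factor into a function of n times a function of l, giving products of zeta values. The remainder
  carries l^(2m) in place of n^(2m), which is the double series at 1/x with its indices
  exchanged.\<close>

lemma double_series_reciprocity:
  fixes x :: complex
  assumes "x \<noteq> 0" "Re (x ^ 2) \<ge> 0" "m \<ge> 1"
  defines "D \<equiv> \<lambda>x::complex. (\<Sum>\<^sub>\<infinity>(n, l)\<in>UNIV \<times> UNIV. 1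
      / (of_nat (Suc n) ^ (2 * m) * (of_nat (Suc l) ^ 2 + of_nat (Suc n) ^ 2 * x ^ 2)))"
  shows "D x = (\<Sum>j<m. (- (x ^ 2)) ^ j * riemann_zeta (of_nat (2 * j + 2))
      * riemann_zeta (of_nat (2 * (m - j)))) + (- (x ^ 2)) ^ m / x ^ 2 * D (1 / x)"
proof -
  let ?f = "\<lambda>x::complex. \<lambda>(n, l). 1
      / (of_nat (Suc n) ^ (2 * m) * (of_nat (Suc l) ^ 2 + of_nat (Suc n) ^ 2 * x ^ 2))"
  have inv: "Re ((1 / x) ^ 2) \<ge> 0"
    using assms(2) by (simp add: power_divide Re_divide)
  have f: "(?f x has_sum D x) (UNIV \<times> UNIV)" if "Re (x ^ 2) \<ge> 0" for x
    unfolding D_def by (intro has_sum_infsum summable_on_double_series that assms)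
  have "((\<lambda>(n, l). 1 / of_nat (Suc n) ^ (2 * (m - j))
      * (1 / of_nat (Suc l) ^ (2 * j + 2))) has_sum
      riemann_zeta (of_nat (2 * (m - j))) * riemann_zeta (of_nat (2 * j + 2))) (UNIV \<times> UNIV)"
    if "j < m" for j
  proof (rule has_sum_Times_mult)
    show "(\<lambda>n. norm (1 / of_nat (Suc n) ^ (2 * (m - j)) :: complex)) summable_on UNIV"
         "(\<lambda>l. norm (1 / of_nat (Suc l) ^ (2 * j + 2) :: complex)) summable_on UNIV"
      using summable_on_inverse_Suc_power[of "2 * (m - j)"] summable_on_inverse_Suc_power[of "2
          * j + 2"] that
      by (simp_all add: norm_divide norm_mult norm_power del: of_nat_Suc power_Suc)
  qed (rule riemann_zeta_has_sum; use that in simp)+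
  hence "((\<lambda>p. \<Sum>j<m. (- (x ^ 2)) ^ j
      * (case p of (n, l) \<Rightarrow> 1 / of_nat (Suc n) ^ (2 * (m - j))
      * (1 / of_nat (Suc l) ^ (2 * j + 2)))) has_sum
      (\<Sum>j<m. (- (x ^ 2)) ^ j * (riemann_zeta (of_nat (2 * (m - j)))
      * riemann_zeta (of_nat (2 * j + 2))))) (UNIV \<times> UNIV)"
    by (intro has_sum_finite_sum has_sum_cmult_right) auto
  \<comment> \<open>Absolute summability at 1/x allows the indices to be swapped; \<open>inv\<close>
    supplies the condition on Re((1/x)^2).\<close>
  moreover have "((\<lambda>p. (- (x ^ 2)) ^ m / x ^ 2 * (case p of (n, l) \<Rightarrow> ?f (1 / x) (l, n))) has_sum
      (- (x ^ 2)) ^ m / x ^ 2 * D (1 / x)) (UNIV \<times> UNIV)"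
    by (intro has_sum_cmult_right, subst has_sum_swap [symmetric]) (rule f[OF inv])
  ultimately have "((\<lambda>p. (\<Sum>j<m. (- (x ^ 2)) ^ j
      * (case p of (n, l) \<Rightarrow> 1 / of_nat (Suc n) ^ (2 * (m - j))
      * (1 / of_nat (Suc l) ^ (2 * j + 2))))
      + (- (x ^ 2)) ^ m / x ^ 2 * (case p of (n, l) \<Rightarrow> ?f (1 / x) (l, n))) has_sum
      (\<Sum>j<m. (- (x ^ 2)) ^ j * (riemann_zeta (of_nat (2 * (m - j)))
      * riemann_zeta (of_nat (2 * j + 2)))) + (- (x ^ 2)) ^ m / x ^ 2 * D (1 / x)) (UNIV \<times> UNIV)"
    by (rule has_sum_add)
  also have "(\<lambda>p. (\<Sum>j<m. (- (x ^ 2)) ^ j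
      * (case p of (n, l) \<Rightarrow> 1 / of_nat (Suc n) ^ (2 * (m - j))
      * (1 / of_nat (Suc l) ^ (2 * j + 2))))
      + (- (x ^ 2)) ^ m / x ^ 2 * (case p of (n, l) \<Rightarrow> ?f (1 / x) (l, n))) = ?f x"
  proof
    fix p :: "nat \<times> nat"
    obtain n l where p: "p = (n, l)"
      by (cases p)
    define t L where "t = (of_nat (Suc n) :: complex) ^ 2" and "L = (of_nat (Suc l) :: complex) ^ 2"
    have nz: "t \<noteq> 0" "L \<noteq> 0"
      by (auto simp: t_def L_def simp del: of_nat_Suc)
    have "Re (L + t * x ^ 2) > 0"
    proof -
      have *: "L = of_real (real (Suc l) ^ 2)" "t = of_real (real (Suc n) ^ 2)"
        by (simp_all add: t_def L_def)
      show ?thesis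
        unfolding * plus_complex.sel times_complex.sel Re_complex_of_real Im_complex_of_real
        using assms(2) by (intro add_pos_nonneg) auto
    qed
    hence nz': "L + t * x ^ 2 \<noteq> 0"
      by (metis less_irrefl zero_complex.sel(1))
    \<comment> \<open>Normalizing the denominator to the shape of the series at 1/x is the origin of
      the factor 1/x^2.\<close>
    have "t + L * (1 / x) ^ 2 = (L + t * x ^ 2) / x ^ 2"
      using assms(1) by (simp add: field_simps)
    hence "(- (x ^ 2)) ^ m / x ^ 2 * (1 / (L ^ m * (t + L * (1 / x) ^ 2))) =
        (- (x ^ 2)) ^ m * (1 / (L ^ m * (L + t * x ^ 2)))"
      using assms(1) by simp
    with partial_fractions_power[OF nz nz', of m]
    have "(\<Sum>j<m. (- (x ^ 2)) ^ j * (1 / t ^ (m - j) * (1 / L ^ (j + 1))))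
        + (- (x ^ 2)) ^ m / x ^ 2 * (1 / (L ^ m * (t + L * (1 / x) ^ 2))) =
        1 / (t ^ m * (L + t * x ^ 2))"
      by (simp only: mult_ac)
    moreover have "of_nat (Suc n) ^ (2 * i) = t ^ i" "of_nat (Suc l) ^ (2 * i) = L ^ i"
                  "of_nat (Suc l) ^ (2 * i + 2) = L ^ (i + 1)" for i
      by (simp_all only: t_def L_def power_mult [symmetric] distrib_left mult_1_right)
    ultimately show "(\<Sum>j<m. (- (x ^ 2)) ^ j
        * (case p of (n, l) \<Rightarrow> 1 / of_nat (Suc n) ^ (2 * (m - j))
        * (1 / of_nat (Suc l) ^ (2 * j + 2))))
        + (- (x ^ 2)) ^ m / x ^ 2 * (case p of (n, l) \<Rightarrow> ?f (1 / x) (l, n)) = ?f x p"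
      by (simp only: p prod.case t_def [symmetric] L_def [symmetric])
  qed
  finally show ?thesis
    using f[OF assms(2)] by (simp add: mult_ac has_sum_unique)
qed

section \<open>Euler's formula for the even zeta values\<close>

lemma coth_partial_fractions_real:
  assumes "x \<noteq> 0"
  shows "(\<lambda>l. 2 * x / (real (Suc l) ^ 2 + x ^ 2)) sums
      (pi * (1 + 2 / (exp (2 * pi * x) - 1)) - 1 / x)"
proof -
  have "(\<lambda>l. complex_of_real (2 * x / (real (Suc l) ^ 2 + x ^ 2))) sums
      complex_of_real (pi * (1 + 2 / (exp (2 * pi * x) - 1)) - 1 / x)"
    using coth_partial_fractions[of "complex_of_real x"] assms
    by (simp add: exp_of_real [symmetric] del: of_nat_Suc)
  thus ?thesis
    by (simp only: sums_of_real_iff)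
qed

text \<open>Expand each 2 x^2 / (l^2 + x^2) as a geometric series in -x^2/l^2 and sum over l first.
  The condition |x| < 1 gives convergence already at l = 1.\<close>

lemma zeta_power_series:
  fixes x :: real
  assumes "x \<noteq> 0" "\<bar>x\<bar> < 1"
  shows "(\<lambda>j. 2 * (- 1) ^ j * x ^ (2 * j + 2) * (\<Sum>\<^sub>\<infinity>l. 1 / real (Suc l) ^ (2 * j + 2))) sums
      (pi * x * (1 + 2 / (exp (2 * pi * x) - 1)) - 1)"
proof -
  let ?f = "\<lambda>(l, j). 2 * (- 1) ^ j * x ^ (2 * j + 2) * (1 / real (Suc l) ^ (2 * j + 2))"
  have geom_summable: "(\<lambda>j. 2 * \<bar>x\<bar> ^ (2 * j + 2)) summable_on UNIV"
  proof -
    have "x ^ 2 < 1"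
      using assms by (simp add: abs_square_less_1)
    hence "summable (\<lambda>j. 2 * x ^ 2 * (x ^ 2) ^ j)"
      by (intro summable_mult summable_geometric) simp
    also have "(\<lambda>j. 2 * x ^ 2 * (x ^ 2) ^ j) = (\<lambda>j. 2 * \<bar>x\<bar> ^ (2 * j + 2))"
    proof
      fix j
      have "\<bar>x\<bar> ^ (2 * j + 2) = x ^ (2 * j + 2)"
        by (rule power_even_abs) simp
      thus "2 * x ^ 2 * (x ^ 2) ^ j = 2 * \<bar>x\<bar> ^ (2 * j + 2)"
        unfolding \<open>\<bar>x\<bar> ^ (2 * j + 2) = _\<close> by (simp add: power_add power_mult power2_eq_square)
    qed
    finally show ?thesis
      by (subst summable_on_UNIV_nonneg_real_iff) auto
  qed
  have summable: "?f summable_on UNIV \<times> UNIV"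
  proof (rule summable_on_Times_dominated)
    show "(\<lambda>l. 1 / real (Suc l) ^ 2) summable_on UNIV"
      by (rule summable_on_inverse_Suc_power) simp
    show "(\<lambda>j. 2 * \<bar>x\<bar> ^ (2 * j + 2)) summable_on UNIV"
      by (rule geom_summable)
    fix l j :: nat
    \<comment> \<open>Lowering the exponent to 2 decouples l from j, as a product bound
      demands.\<close>
    have "real (Suc l) ^ 2 \<le> real (Suc l) ^ (2 * j + 2)"
      by (rule power_increasing) auto
    hence "1 / real (Suc l) ^ (2 * j + 2) \<le> 1 / real (Suc l) ^ 2"
      by (intro divide_left_mono) auto
    hence "2 * \<bar>x\<bar> ^ (2 * j + 2) * (1 / real (Suc l) ^ (2 * j + 2)) \<le>
        2 * \<bar>x\<bar> ^ (2 * j + 2) * (1 / real (Suc l) ^ 2)"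
      by (intro mult_left_mono) auto
    thus "norm (?f (l, j)) \<le> 1 / real (Suc l) ^ 2 * (2 * \<bar>x\<bar> ^ (2 * j + 2))"
      by (simp add: abs_mult power_abs mult_ac del: of_nat_Suc power_Suc)
  qed auto
  define S where "S = infsum ?f (UNIV \<times> UNIV)"
  have S: "(?f has_sum S) (UNIV \<times> UNIV)"
    unfolding S_def by (rule has_sum_infsum[OF summable])
  have row: "((\<lambda>j. ?f (l, j)) has_sum x * (2 * x / (real (Suc l) ^ 2 + x ^ 2))) UNIV" for l
  proof (rule sums_imp_has_sum)
    show "(\<lambda>j. ?f (l, j)) summable_on UNIV"
      using summable_on_SigmaD1[OF summable, of l] by simp
    define c where "c = real (Suc l)"
    have "c \<ge> 1" by (simp add: c_def)
    have "x ^ 2 / c ^ 2 < 1"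
    proof -
      have "x ^ 2 < 1"
        using assms by (simp add: abs_square_less_1)
      also have "1 \<le> c ^ 2"
        using \<open>c \<ge> 1\<close> by simp
      finally show ?thesis
        using \<open>c \<ge> 1\<close> by simp
    qed
    hence "(\<lambda>j. 2 * x ^ 2 / c ^ 2 * (- (x ^ 2 / c ^ 2)) ^ j) sums
        (2 * x ^ 2 / c ^ 2 * (1 / (1 - (- (x ^ 2 / c ^ 2)))))"
      by (intro sums_mult geometric_sums) simp
    also have "2 * x ^ 2 / c ^ 2 * (1 / (1 - (- (x ^ 2 / c ^ 2)))) = x * (2 * x / (c ^ 2 + x ^ 2))"
    proof -
      have "1 - (- (x ^ 2 / c ^ 2)) = (c ^ 2 + x ^ 2) / c ^ 2"
        using \<open>c \<ge> 1\<close> by (simp add: field_simps)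
      thus ?thesis
        using \<open>c \<ge> 1\<close> by (simp add: power2_eq_square)
    qed
    also have "(\<lambda>j. 2 * x ^ 2 / c ^ 2 * (- (x ^ 2 / c ^ 2)) ^ j) = (\<lambda>j. ?f (l, j))"
    proof
      fix j
      have "(- (x ^ 2 / c ^ 2)) ^ j = (- 1) ^ j * x ^ (2 * j) / c ^ (2 * j)"
        by (subst power_minus) (simp add: power_divide power_mult)
      thus "2 * x ^ 2 / c ^ 2 * (- (x ^ 2 / c ^ 2)) ^ j = ?f (l, j)"
        unfolding c_def by (simp add: power_add mult_ac power2_eq_square del: of_nat_Suc)
    qed
    finally show "(\<lambda>j. ?f (l, j)) sums (x * (2 * x / (real (Suc l) ^ 2 + x ^ 2)))"
      by (simp only: c_def)
  qed
  have "(\<lambda>l. x * (2 * x / (real (Suc l) ^ 2 + x ^ 2))) sums S"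
    by (rule has_sum_imp_sums, rule has_sum_SigmaD[OF S row])
  moreover have "(\<lambda>l. x * (2 * x / (real (Suc l) ^ 2 + x ^ 2))) sums
      (x * (pi * (1 + 2 / (exp (2 * pi * x) - 1)) - 1 / x))"
    by (intro sums_mult coth_partial_fractions_real assms)
  ultimately have "S = x * (pi * (1 + 2 / (exp (2 * pi * x) - 1)) - 1 / x)"
    by (rule sums_unique2)
  also have "\<dots> = pi * x * (1 + 2 / (exp (2 * pi * x) - 1)) - 1"
    using assms by (simp add: right_diff_distrib)
  finally have S_eq: "S = \<dots>" .
  have "((\<lambda>(j, l). ?f (l, j)) has_sum S) (UNIV \<times> UNIV)"
    using S by (subst (asm) has_sum_swap)
  hence "((\<lambda>j. 2 * (- 1) ^ j * x ^ (2 * j + 2) * (\<Sum>\<^sub>\<infinity>l. 1 / real (Suc l) ^ (2 * j + 2))) has_sum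
      S) UNIV"
  proof (rule has_sum_SigmaD)
    show "((\<lambda>l. case (j, l) of (j, l) \<Rightarrow> ?f (l, j)) has_sum
        2 * (- 1) ^ j * x ^ (2 * j + 2) * (\<Sum>\<^sub>\<infinity>l. 1 / real (Suc l) ^ (2 * j + 2))) UNIV" for j
      unfolding prod.case
      by (intro has_sum_cmult_right has_sum_infsum summable_on_inverse_Suc_power) simp
  qed
  thus ?thesis
    unfolding S_eq by (rule has_sum_imp_sums)
qed

text \<open>The zero function expands to H = F - G. Divided by x^n, n being the order of H, it gives
  a function that is 0 away from 0 and has the leading coefficient of H as its value at 0.
  Continuity forces that coefficient to vanish.\<close>

lemma has_fps_expansion_unique:
  fixes F G :: "'a :: {banach, real_normed_field} fps"
  assumes "f has_fps_expansion F" "f has_fps_expansion G"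
  shows "F = G"
proof (rule ccontr)
  assume "F \<noteq> G"
  define H where "H = F - G"
  define n where "n = subdegree H"
  have "H \<noteq> 0"
    using \<open>F \<noteq> G\<close> by (simp add: H_def)
  have "(\<lambda>x. f x - f x) has_fps_expansion H"
    unfolding H_def by (intro has_fps_expansion_diff assms)
  hence "(\<lambda>x. if x = 0 then fps_nth H n else (f x - f x) / x ^ n) has_fps_expansion fps_shift n H"
    by (rule has_fps_expansion_shift) (simp_all add: n_def)
  hence "(\<lambda>x. if x = 0 then fps_nth H n else 0) has_fps_expansion fps_shift n H"
    by (simp cong: if_cong)
  from has_fps_expansion_imp_continuous[OF this, of UNIV]
  have "((\<lambda>x::'a. if x = 0 then fps_nth H n else 0) \<longlongrightarrow> fps_nth H n) (at 0)"
    by (simp add: continuous_within)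
  moreover have "((\<lambda>x::'a. if x = 0 then fps_nth H n else 0) \<longlongrightarrow> 0) (at 0)"
    by (rule tendsto_eventually) (auto simp: eventually_at_filter)
  ultimately have "fps_nth H n = 0"
    by (rule LIM_unique)
  with \<open>H \<noteq> 0\<close> show False
    by (simp add: n_def)
qed

text \<open>This passes from the formal quotient defining \<open>bernoulli\<close> to an actual
  function near 0, with the removable singularity filled by 1.\<close>

lemma bernoulli_has_fps_expansion:
  "(\<lambda>t::real. if t = 0 then 1 else t / (exp t - 1)) has_fps_expansion fps_X / (fps_exp 1 - 1)"
proof (rule has_fps_expansion_divide)
  have "subdegree (fps_exp 1 - 1 :: real fps) = 1"
    by (rule subdegreeI) auto
  thus "subdegree (fps_exp 1 - 1 :: real fps) \<le> subdegree (fps_X :: real fps)"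
       "1 = fps_nth fps_X (subdegree (fps_exp 1 - 1 :: real fps))
           / fps_nth (fps_exp 1 - 1 :: real fps) (subdegree (fps_exp 1 - 1 :: real fps))"
       "fps_exp 1 - 1 \<noteq> (0 :: real fps)"
    by auto
qed (auto intro!: fps_expansion_intros)

lemma bernoulli_0: "bernoulli 0 = 1"
  using bernoulli_has_fps_expansion
  by (auto simp: bernoulli_def has_fps_expansion_def eval_fps_at_0 dest!: eventually_nhds_x_imp_x)

text \<open>Both sides are, up to the same factor, Taylor coefficients of t / (exp t - 1): one by
  the definition of \<open>bernoulli\<close>, the other by \<open>zeta_power_series\<close> at x = t
  / (2 pi). Uniqueness of the expansion equates them.\<close>

lemma infsum_inverse_even_power:
  assumes "j \<ge> 1"
  shows "(\<Sum>\<^sub>\<infinity>l. 1 / real (Suc l) ^ (2 * j)) =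
      (- 1) ^ (j + 1) * bernoulli (2 * j) * (2 * pi) ^ (2 * j) / (2 * fact (2 * j))"
proof -
  define Z where "Z = (\<lambda>n. \<Sum>\<^sub>\<infinity>l. 1 / real (Suc l) ^ n)"
  \<comment> \<open>With t = 2 pi x, pi x coth(pi x) = t / (exp t - 1) + t/2. So \<open>F\<close>
    takes its even coefficients from the zeta series, and its linear coefficient -1/2 from the
    correction t/2.\<close>
  define c where "c = (\<lambda>n. 2 * (- 1) ^ (n div 2 + 1) * Z n / (2 * pi) ^ n)"
  define F where "F = Abs_fps (\<lambda>n. if n = 0 then 1 else if n =
      1 then - 1 / 2 else if even n then c n else 0)"
  have "(\<lambda>n. fps_nth F n * t ^ n) sums (if t = 0 then 1 else t / (exp t - 1))" if "\<bar>t\<bar> < 2 * pi"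
      for t
  proof (cases "t = 0")
    case False
    define x where "x = t / (2 * pi)"
    have "x \<noteq> 0" "\<bar>x\<bar> < 1" and t: "t = 2 * pi * x"
      using False that by (simp_all add: x_def abs_divide)
    define g where "g = (\<lambda>j::nat. 2 * j + 2)"
    \<comment> \<open>\<open>?h\<close> leaves out the terms of degree 0 and 1; the remaining
      nonzero ones have even degree from 2 on, which \<open>g\<close> enumerates.\<close>
    let ?h = "\<lambda>n. if n \<in> {0, 1} then 0 else fps_nth F n * t ^ n"
    have "(\<lambda>j. 2 * (- 1) ^ j * x ^ (2 * j + 2) * Z (2 * j + 2)) = (\<lambda>j. ?h (g j))"
      by (simp add: F_def g_def c_def t power_mult_distrib fun_eq_iff)
    hence "(\<lambda>j. ?h (g j)) sums (pi * x * (1 + 2 / (exp (2 * pi * x) - 1)) - 1)"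
      using zeta_power_series[OF \<open>x \<noteq> 0\<close> \<open>\<bar>x\<bar> < 1\<close>] by (simp only: Z_def)
    also have "?this \<longleftrightarrow> ?h sums (pi * x * (1 + 2 / (exp (2 * pi * x) - 1)) - 1)"
    proof (rule sums_mono_reindex)
      show "strict_mono g"
        by (auto simp: g_def strict_mono_def)
      show "?h n = 0" if "n \<notin> range g" for n
      proof (cases "even n \<and> n > 0")
        case True
        hence "n = g (n div 2 - 1)"
          by (auto simp: g_def elim!: evenE)
        with that show ?thesis by blast
      qed (auto simp: F_def)
    qed
    finally have "(\<lambda>n. ?h n + (if n \<in> {0, 1} then fps_nth F n * t ^ n else 0)) sums
        ((pi * x * (1 + 2 / (exp (2 * pi * x) - 1)) - 1) + (\<Sum>n\<in>{0, 1}. fps_nth F n * t ^ n))"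
      by (intro sums_add sums_If_finite_set) auto
    also have "(\<lambda>n. ?h n + (if n \<in> {0, 1} then fps_nth F n * t ^ n else 0)) =
        (\<lambda>n. fps_nth F n * t ^ n)"
      by auto
    also have "(\<Sum>n\<in>{0, 1}. fps_nth F n * t ^ n) = 1 - t / 2"
      by (simp add: F_def)
    also have "(pi * x * (1 + 2 / (exp (2 * pi * x) - 1)) - 1) + (1 - t / 2) = t / (exp t - 1)"
      by (simp add: t ring_distribs)
    finally show ?thesis
      using False by simp
  next
    case True
    have "(\<lambda>n. fps_nth F n * 0 ^ n) sums (fps_nth F 0 * 0 ^ 0)"
      using powser_sums_zero[of "fps_nth F"] by simp
    thus ?thesis
      using True by (simp add: F_def)
  qed
  moreover have "eventually (\<lambda>t::real. \<bar>t\<bar> < 2 * pi) (nhds 0)"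
    by (rule eventually_nhds_in_open[of "{t. \<bar>t\<bar> < 2 * pi}", simplified])
       (auto intro!: open_Collect_less continuous_intros)
  ultimately have "(\<lambda>t. if t = 0 then 1 else t / (exp t - 1)) has_fps_expansion F"
    by (intro has_fps_expansionI) (rule eventually_mono)
  hence "F = fps_X / (fps_exp 1 - 1)"
    by (rule has_fps_expansion_unique[OF _ bernoulli_has_fps_expansion])
  hence "bernoulli (2 * j) = fact (2 * j) * fps_nth F (2 * j)"
    by (simp add: bernoulli_def)
  also have "\<dots> = fact (2 * j) * c (2 * j)"
    using assms by (simp add: F_def)
  finally show ?thesis
    by (simp add: c_def Z_def field_simps flip: power_add)
qed

lemma riemann_zeta_even:
  assumes "j \<ge> 1"
  shows "riemann_zeta (of_nat (2 * j)) =
      of_real ((- 1) ^ (j + 1) * bernoulli (2 * j) * (2 * pi) ^ (2 * j) / (2 * fact (2 * j)))"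
proof -
  have "((\<lambda>l. complex_of_real (1 / real (Suc l) ^ (2 * j))) has_sum
      of_real (\<Sum>\<^sub>\<infinity>l. 1 / real (Suc l) ^ (2 * j))) UNIV"
    using assms by (intro has_sum_of_real has_sum_infsum summable_on_inverse_Suc_power) auto
  moreover have "((\<lambda>l. complex_of_real (1 / real (Suc l) ^ (2 * j))) has_sum
      riemann_zeta (of_nat (2 * j))) UNIV"
    using riemann_zeta_has_sum[of "2 * j"] assms by simp
  ultimately show ?thesis
    using infsum_inverse_even_power[OF assms] has_sum_unique by metis
qed

section \<open>Ramanujan's formula\<close>

text \<open>Write both zeta-Lambert sums through the double series at x and 1/x and apply
  reciprocity. Only even zeta values survive, and Euler's formula turns them into Bernoulli
  numbers.\<close>

lemma ramanujan_formula:
  fixes x :: complex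
  assumes "Re x > 0" "Re (x ^ 2) \<ge> 0" "m \<ge> 1"
  defines "\<beta> \<equiv> \<lambda>j. of_real (bernoulli (2 * j) * bernoulli (2 * m + 2 - 2 * j)
      / (fact (2 * j) * fact (2 * m + 2 - 2 * j)))"
  shows "(riemann_zeta (of_nat (2 * m + 1))
      + 2 * lambert_series (exp (- 2 * pi * x)) (- of_nat (2 * m + 1)))
      - (- (x ^ 2)) ^ m * (riemann_zeta (of_nat (2 * m + 1))
      + 2 * lambert_series (exp (- 2 * pi / x)) (- of_nat (2 * m + 1))) =
      (- 1) ^ m * (2 * pi) ^ (2 * m + 1) * (\<Sum>j\<le>Suc m. (- 1) ^ j * x powi (2 * int j - 1) * \<beta> j)"
  (is "?A - ?y ^ m * ?B = ?P * ?S")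
proof -
  define D where "D = (\<lambda>x::complex. (\<Sum>\<^sub>\<infinity>(n, l)\<in>UNIV \<times> UNIV. 1
      / (of_nat (Suc n) ^ (2 * m) * (of_nat (Suc l) ^ 2 + of_nat (Suc n) ^ 2 * x ^ 2))))"
  define c where "c = (\<lambda>j. riemann_zeta (of_nat (2 * j + 2)) * riemann_zeta (of_nat (2 * (m - j))))"
  define z where "z = riemann_zeta (of_nat (2 * m + 2))"
  have x: "x \<noteq> 0"
    using assms(1) by auto
  have inv: "Re (1 / x) > 0" "Re ((1 / x) ^ 2) \<ge> 0"
    using assms(1,2) x by (simp_all add: power_divide Re_divide cmod_power2 [symmetric])
  have A: "pi * ?A = z / x + 2 * x * D x"
    unfolding z_def D_def by (rule lambert_series_eq_double_series[OF assms(1-3)])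
  have B: "pi * ?B = z * x + 2 / x * D (1 / x)"
    using lambert_series_eq_double_series[OF inv assms(3)] unfolding z_def D_def by simp
  have D: "D x = (\<Sum>j<m. ?y ^ j * c j) + ?y ^ m / x ^ 2 * D (1 / x)"
    unfolding D_def c_def mult.assoc [symmetric]
        by (rule double_series_reciprocity[OF x assms(2,3)])
  \<comment> \<open>The terms with D(1/x) cancel: 2 x * y^m / x^2 from \<open>D\<close> matches y^m
    * 2 / x from \<open>B\<close>.\<close>
  have "pi * (?A - ?y ^ m * ?B) = z / x + 2 * x * (\<Sum>j<m. ?y ^ j * c j) - ?y ^ m * z * x"
    unfolding right_diff_distrib mult.left_commute[of "of_real pi" "?y ^ m"] A B D
    using x by (simp add: algebra_simps power2_eq_square)
  also have "\<dots> = pi * (?P * ?S)"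
  proof -
    have z: "z = (- 1) ^ m * (2 * pi) ^ (2 * m + 2) * \<beta> 0 / 2"
      using riemann_zeta_even[of "m + 1"] unfolding z_def by (simp add: \<beta>_def bernoulli_0)
    have \<beta>_last: "\<beta> (Suc m) = \<beta> 0"
      by (simp add: \<beta>_def)
    have c: "c j = (- 1) ^ (m + 1) * (2 * pi) ^ (2 * m + 2) * \<beta> (Suc j) / 4" if "j < m" for j
    proof -
      have "2 * m + 2 - 2 * Suc j = 2 * (m - j)" by simp
      have "(2 * pi) ^ (2 * (j + 1)) * (2 * pi) ^ (2 * (m - j)) = (2 * pi) ^ (2 * m + 2)"
        using that by (simp flip: power_add add: algebra_simps)
      moreover have "(- 1) ^ (j + 1 + 1) * (- 1) ^ (m - j + 1) = ((- 1) ^ (m + 1) :: real)"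
        using that by (simp flip: power_add)
      moreover have "s * b * p / (2 * f) * (s' * b' * p' / (2 * f')) =
          (s * s') * (p * p') * (b * b' / (f * f')) / 4"
        for s b p f s' b' p' f' :: real
        by (simp add: mult_ac)
      ultimately have "(- 1) ^ (j + 1 + 1) * bernoulli (2 * (j + 1)) * (2 * pi) ^ (2 * (j + 1))
          / (2 * fact (2 * (j + 1)))
          * ((- 1) ^ (m - j + 1) * bernoulli (2 * (m - j)) * (2 * pi) ^ (2 * (m - j))
          / (2 * fact (2 * (m - j)))) =
          (- 1) ^ (m + 1) * (2 * pi) ^ (2 * m + 2)
          * (bernoulli (2 * Suc j) * bernoulli (2 * m + 2 - 2 * Suc j)
          / (fact (2 * Suc j) * fact (2 * m + 2 - 2 * Suc j))) / 4"
        unfolding \<open>2 * m + 2 - 2 * Suc j = 2 * (m - j)\<close> by (simp only: Suc_eq_plus1)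
      moreover have "c j = of_real ((- 1) ^ (j + 1 + 1) * bernoulli (2 * (j + 1))
          * (2 * pi) ^ (2 * (j + 1)) / (2 * fact (2 * (j + 1))))
          * of_real ((- 1) ^ (m - j + 1) * bernoulli (2 * (m - j)) * (2 * pi) ^ (2 * (m - j))
          / (2 * fact (2 * (m - j))))"
        using that riemann_zeta_even[of "j + 1"] riemann_zeta_even[of "m - j"] by (simp add: c_def)
      ultimately show ?thesis
        unfolding \<beta>_def of_real_mult [symmetric] by simp
    qed
    \<comment> \<open>The two end terms j = 0 and j = m + 1 correspond to the summands with
      zeta(2m+2); the inner ones correspond to the products \<open>c j\<close>.\<close>
    have S_eq: "?S = \<beta> 0 / x + (\<Sum>j<m. (- 1) ^ Suc j * x powi (2 * int (Suc j) - 1) * \<beta> (Suc j))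
        + (- 1) ^ Suc m * x powi (2 * int (Suc m) - 1) * \<beta> 0"
      unfolding sum.atMost_Suc
          unfolding lessThan_Suc_atMost [symmetric] sum.lessThan_Suc_shift \<beta>_last
      by (simp add: power_int_minus divide_inverse mult.commute)
    have powi_eq: "x powi (2 * int (Suc j) - 1) = x * (x ^ 2) ^ j" for j
    proof -
      have "2 * int (Suc j) - 1 = int (2 * j + 1)" by simp
      thus ?thesis
        by (simp only: power_int_of_nat) (simp add: power_mult)
    qed
    have "pi * (?P * (\<beta> 0 / x + (\<Sum>j<m. (- 1) ^ Suc j * (x * (x ^ 2) ^ j) * \<beta> (Suc j))
        + (- 1) ^ Suc m * (x * (x ^ 2) ^ m) * \<beta> 0)) =
        z / x + 2 * x * (\<Sum>j<m. ?y ^ j * c j) - ?y ^ m * z * x"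
    proof -
      have "pi * ?P = (- 1) ^ m * (2 * pi) ^ (2 * m + 2) / 2"
        by simp
      hence "pi * (?P * (\<beta> 0 / x + (\<Sum>j<m. (- 1) ^ Suc j * (x * (x ^ 2) ^ j) * \<beta> (Suc j))
          + (- 1) ^ Suc m * (x * (x ^ 2) ^ m) * \<beta> 0)) =
          (- 1) ^ m * (2 * pi) ^ (2 * m + 2) / 2
          * (\<beta> 0 / x + (\<Sum>j<m. (- 1) ^ Suc j * (x * (x ^ 2) ^ j) * \<beta> (Suc j))
          + (- 1) ^ Suc m * (x * (x ^ 2) ^ m) * \<beta> 0)"
        by (simp only: mult.assoc [symmetric])
      also have "\<dots> = z / x + (\<Sum>j<m. (- 1) ^ m * (2 * pi) ^ (2 * m + 2) / 2
          * ((- 1) ^ Suc j * (x * (x ^ 2) ^ j) * \<beta> (Suc j)))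
          + (- 1) ^ Suc m * (x * (x ^ 2) ^ m) * z"
        unfolding z distrib_left sum_distrib_left by (simp add: mult_ac)
      also have "(\<Sum>j<m. (- 1) ^ m * (2 * pi) ^ (2 * m + 2) / 2
          * ((- 1) ^ Suc j * (x * (x ^ 2) ^ j) * \<beta> (Suc j))) = (\<Sum>j<m. 2 * x * (?y ^ j * c j))"
      proof (intro sum.cong refl)
        fix j assume "j \<in> {..<m}"
        have "?y ^ j = (- 1) ^ j * (x ^ 2) ^ j"
          by (rule power_minus)
        thus "(- 1) ^ m * (2 * pi) ^ (2 * m + 2) / 2
            * ((- 1) ^ Suc j * (x * (x ^ 2) ^ j) * \<beta> (Suc j)) = 2 * x * (?y ^ j * c j)"
          using c[of j] \<open>j \<in> {..<m}\<close> by simp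
      qed
      also have "(- 1) ^ Suc m * (x * (x ^ 2) ^ m) * z = - (?y ^ m * z * x)"
        unfolding power_minus[of "x ^ 2"] by simp
      finally show ?thesis
        by (simp add: sum_distrib_left)
    qed
    thus ?thesis
      unfolding S_eq powi_eq by (rule sym)
  qed
  finally show ?thesis
    by simp
qed

section \<open>Specialization to x = 2 and x = 1 - i\<close>

text \<open>The Bernoulli products in Ramanujan's formula for m = 2k are invariant under j -> 2k + 1
  - j, so pairing these indices leaves a sum over j <= k.\<close>

lemma sum_atMost_fold_symmetric:
  fixes g :: "nat \<Rightarrow> 'a :: comm_monoid_add"
  shows "(\<Sum>j\<le>Suc (2 * k). g j) = (\<Sum>j\<le>k. g j + g (2 * k + 1 - j))"
proof -
  have "{..Suc (2 * k)} = {..k} \<union> {k<..Suc (2 * k)}"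
    by auto
  hence "(\<Sum>j\<le>Suc (2 * k). g j) = (\<Sum>j\<le>k. g j) + (\<Sum>j\<in>{k<..Suc (2 * k)}. g j)"
    by (simp only:) (rule sum.union_disjoint; auto)
  also have "(\<Sum>j\<in>{k<..Suc (2 * k)}. g j) = (\<Sum>j\<le>k. g (2 * k + 1 - j))"
    by (rule sum.reindex_bij_witness[of _ "\<lambda>j. 2 * k + 1 - j" "\<lambda>j. 2 * k + 1 - j"]) auto
  finally show ?thesis
    by (simp add: sum.distrib)
qed

lemma one_plus_ii_power: "(1 + \<i>) ^ (4 * k) = (- 4) ^ k"
proof -
  have "(1 + \<i>) ^ 4 = - 4"
    by (simp add: power4_eq_xxxx complex_eq_iff)
  thus ?thesis
    by (simp add: power_mult)
qed

text \<open>Since 2 = (1 - i)(1 + i), the left side is (1 - i)^a (1 + i)^(a + b), and (1 + i)^4 =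
  -4. This is how powers of 1 - i become the powers of 1 + i in \<open>coeff_b\<close>.\<close>

lemma two_powi_mult_one_plus_ii_powi:
  assumes "a + b = 4 * int k"
  shows "2 powi a * (1 + \<i>) powi b = (- 4) ^ k * (1 - \<i>) powi a"
proof -
  have nz: "1 + \<i> \<noteq> 0"
    by (simp add: complex_eq_iff)
  have "(2 :: complex) = (1 - \<i>) * (1 + \<i>)"
    by (simp add: complex_eq_iff)
  hence "2 powi a * (1 + \<i>) powi b = (1 - \<i>) powi a * ((1 + \<i>) powi a * (1 + \<i>) powi b)"
    by (simp only: power_int_mult_distrib mult.assoc)
  also have "(1 + \<i>) powi a * (1 + \<i>) powi b = (1 + \<i>) powi int (4 * k)"
    using nz assms by (simp flip: power_int_add)
  also have "\<dots> = (- 4) ^ k"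
    by (simp only: power_int_of_nat one_plus_ii_power)
  finally show ?thesis
    by simp
qed

text \<open>This justifies the division by a_k. With X = 4^k >= 4, a_k >= 2 X^2 - X - 1 >= 7 X - 1 >
  0.\<close>

lemma coeff_a_pos:
  assumes "k \<ge> 1"
  shows "coeff_a k > 0"
proof -
  have pow: "4 \<le> (4 :: real) ^ k"
    using power_increasing[OF assms, of "4 :: real"] by simp
  hence "4 * (4 :: real) ^ k \<le> 4 ^ k * 4 ^ k"
    by (intro mult_right_mono) auto
  moreover have "(- 1) ^ k * (4 :: real) ^ k \<le> 4 ^ k"
    by (cases "even k") auto
  moreover have "coeff_a k = 2 * (4 ^ k * 4 ^ k) - (- 1) ^ k * 4 ^ k - 1"
    by (simp add: coeff_a_def power_mult flip: power_mult_distrib)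
  ultimately show ?thesis
    using pow by linarith
qed

theorem theorem3p2:
  fixes k :: nat
  assumes "k \<ge> 1"
  shows "riemann_zeta (4 * of_nat k + 1) =
    (2 * of_real pi) ^ (4 * k + 1) *
      (\<Sum>j = 0..k. (- 1) ^ (j + 1) * coeff_b j k
          * of_real (bernoulli (2 * j)) * of_real (bernoulli (4 * k + 2 - 2 * j))
          / (fact (2 * j) * fact (4 * k + 2 - 2 * j)))
    - of_real ((2 * coeff_a k + 4) / coeff_a k)
        * lambert_series (of_real (exp (- 2 * pi))) (- 4 * of_nat k - 1)
    + of_real (4 / coeff_a k)
        * lambert_series (of_real (exp (- 4 * pi))) (- 4 * of_nat k - 1)"
proof -
  define p where "p = 2 * (2 * k) + 1"
  define \<zeta> where "\<zeta> = riemann_zeta (of_nat p)"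
  define L where "L = (\<lambda>q. lambert_series q (- of_nat p))"
  define P where "P = (2 * complex_of_real pi) ^ p"
  \<comment> \<open>The factor (-x^2)^(2k) equals u^2 at x = 2 and (2i)^(2k) = u at x = 1 - i;
    moreover a_k = 2 u^2 - u - 1.\<close>
  define u where "u = (- 4 :: complex) ^ k"
  define a where "a = complex_of_real (coeff_a k)"
  define \<beta> where "\<beta> = (\<lambda>j. complex_of_real (bernoulli (2 * j)
      * bernoulli (2 * (2 * k) + 2 - 2 * j) / (fact (2 * j) * fact (2 * (2 * k) + 2 - 2 * j))))"
  define T where "T = (\<lambda>x::complex. \<Sum>j\<le>Suc (2 * k). (- 1) ^ j * x powi (2 * int j - 1) * \<beta> j)"
  define S where "S = (\<Sum>j\<le>k. (- 1) ^ (j + 1) * coeff_b j k * \<beta> j)"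
  define q where "q = complex_of_real (exp (- pi))"

  have a: "a \<noteq> 0"
    using coeff_a_pos[OF assms] by (simp add: a_def)
  have "u ^ 2 = ((- 4) ^ 2) ^ k"
    by (simp only: u_def mult.commute flip: power_mult)
  hence u_sq: "u ^ 2 = 16 ^ k"
    by simp
  have two_p: "(2 :: complex) ^ p = 2 * u ^ 2"
    by (simp add: u_sq p_def power_mult)
  have a_eq: "a = 2 * u ^ 2 - u - 1"
  proof -
    have "u = (- 1) ^ k * 2 ^ (2 * k)"
      by (simp add: u_def power_mult flip: power_mult_distrib)
    moreover have "a = 2 ^ p - (- 1) ^ k * 2 ^ (2 * k) - 1"
      by (simp add: a_def coeff_a_def p_def)
    ultimately show ?thesis
      using two_p by simp
  qed

  have ramanujan: "(\<zeta> + 2 * L (exp (- 2 * pi * x)))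
      - (- (x ^ 2)) ^ (2 * k) * (\<zeta> + 2 * L (exp (- 2 * pi / x))) = P * T x"
    if "Re x > 0" "Re (x ^ 2) \<ge> 0" for x :: complex
    using ramanujan_formula[OF that, of "2 * k"] assms
    by (simp add: \<zeta>_def L_def P_def T_def \<beta>_def p_def)

  have at_2: "(\<zeta> + 2 * L (q ^ 4)) - u ^ 2 * (\<zeta> + 2 * L q) = P * T 2"
  proof -
    have "(- (2 ^ 2)) ^ (2 * k) = u ^ 2"
      by (simp add: u_sq power_mult)
    moreover have "exp (complex_of_real (- 2 * pi) * 2) = q ^ 4"
        "exp (complex_of_real (- 2 * pi) / 2) = q"
      by (simp_all add: q_def exp_of_real [symmetric] flip: exp_of_nat_mult)
    ultimately show ?thesis
      using ramanujan[of 2] by simp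
  qed
  have at_1_minus_ii: "(\<zeta> + 2 * L (q ^ 2)) - u * (\<zeta> + 2 * L (- q)) = P * T (1 - \<i>)"
  proof -
    have sq: "(1 - \<i>) ^ 2 = - 2 * \<i>"
      by (simp add: power2_eq_square complex_eq_iff)
    have "(- ((1 - \<i>) ^ 2)) ^ (2 * k) = u"
      unfolding sq by (simp add: u_def power_mult power_mult_distrib)
    moreover have "exp (complex_of_real (- 2 * pi) * (1 - \<i>)) = q ^ 2"
    proof -
      have "complex_of_real (- 2 * pi) * (1 - \<i>) = of_real (- (2 * pi)) + 2 * of_real pi * \<i>"
        by (simp add: algebra_simps)
      thus ?thesis
        by (simp only: exp_add exp_two_pi_i) (simp add: q_def exp_of_real [symmetric] flip: exp_of_nat_mult)
    qed
    \<comment> \<open>As 1/(1 - i) = (1 + i)/2, the exponent is -pi - pi i, and exp(-pi i) = -1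
      makes the argument negative.\<close>
    moreover have "exp (complex_of_real (- 2 * pi) / (1 - \<i>)) = - q"
    proof -
      have "1 / (1 - \<i>) = (1 + \<i>) / 2"
        by (simp add: complex_eq_iff Re_divide Im_divide)
      hence "complex_of_real (- 2 * pi) / (1 - \<i>) = of_real (- 2 * pi) * ((1 + \<i>) / 2)"
        by (metis mult.right_neutral times_divide_eq_right)
      also have "\<dots> = of_real (- pi) - of_real pi * \<i>"
        by (simp add: complex_eq_iff)
      finally show ?thesis
        by (simp only: exp_diff) (simp add: q_def exp_of_real [symmetric])
    qed
    ultimately show ?thesis
      using ramanujan[of "1 - \<i>"] unfolding sq by simp
  qed
  have minus: "L q + L (- q) = 2 * (1 + 1 / 2 ^ p) * L (q ^ 2) - 2 / 2 ^ p * L (q ^ 4)"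
    unfolding L_def by (rule lambert_series_add_minus) (simp add: q_def)
  have "2 ^ p * (L q + L (- q)) = (2 * 2 ^ p + 2) * L (q ^ 2) - 2 * L (q ^ 4)"
    unfolding minus by (simp add: right_diff_distrib distrib_left distrib_right)
  hence hecke: "2 * u ^ 2 * (L q + L (- q)) = (4 * u ^ 2 + 2) * L (q ^ 2) - 2 * L (q ^ 4)"
    by (simp add: two_p)

  have T_fold: "T x = (\<Sum>j\<le>k. (- 1) ^ j
      * (x powi (2 * int j - 1) - x powi (4 * int k + 1 - 2 * int j)) * \<beta> j)" for x
    unfolding T_def sum_atMost_fold_symmetric
  proof (intro sum.cong refl)
    fix j assume "j \<in> {..k}"
    hence j: "j \<le> k" by simp
    have "\<beta> (2 * k + 1 - j) = \<beta> j"
    proof -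
      have "2 * (2 * k + 1 - j) = 2 * (2 * k) + 2 - 2 * j"
          "2 * (2 * k) + 2 - 2 * (2 * k + 1 - j) = 2 * j"
        using j by auto
      thus ?thesis
        by (simp only: \<beta>_def mult.commute)
    qed
    moreover have "(- 1 :: complex) ^ (2 * k + 1 - j) = - ((- 1) ^ j)"
      using j by (cases "even j") auto
    moreover have "2 * int (2 * k + 1 - j) - 1 = 4 * int k + 1 - 2 * int j"
      using j by (simp add: of_nat_diff)
    ultimately show "(- 1) ^ j * x powi (2 * int j - 1) * \<beta> j
        + (- 1) ^ (2 * k + 1 - j) * x powi (2 * int (2 * k + 1 - j) - 1) * \<beta> (2 * k + 1 - j) =
        (- 1) ^ j * (x powi (2 * int j - 1) - x powi (4 * int k + 1 - 2 * int j)) * \<beta> j"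
      by (simp add: algebra_simps)
  qed
  \<comment> \<open>The weights 1 and u are chosen so that L(q) and L(-q) enter \<open>at_2\<close>
    and u times \<open>at_1_minus_ii\<close> with the same coefficient -2 u^2. Then only their sum
    occurs, which \<open>hecke\<close> eliminates.\<close>
  have S: "a * S = - (T 2 + u * T (1 - \<i>))"
    unfolding S_def T_fold sum_distrib_left sum.distrib [symmetric] sum_negf [symmetric]
  proof (intro sum.cong refl)
    fix j
    \<comment> \<open>The exponents add up to 4k, so \<open>two_powi_mult_one_plus_ii_powi\<close>
      applies to them in both orders.\<close>
    let ?r = "2 * int j - 1" and ?s = "4 * int k + 1 - 2 * int j"
    have "a * coeff_b j k = 2 powi ?r * (1 + (1 + \<i>) powi ?s) - 2 powi ?s * (1 + (1 + \<i>) powi ?r)"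
      using a by (simp add: coeff_b_def a_def)
    also have "\<dots> = (2 powi ?r - 2 powi ?s) + u * ((1 - \<i>) powi ?r - (1 - \<i>) powi ?s)"
      using two_powi_mult_one_plus_ii_powi[of ?r ?s k] two_powi_mult_one_plus_ii_powi[of ?s ?r k]
      by (simp add: ring_distribs u_def)
    finally have "a * ((- 1) ^ (j + 1) * coeff_b j k * \<beta> j) =
        - ((- 1) ^ j * ((2 powi ?r - 2 powi ?s) + u * ((1 - \<i>) powi ?r - (1 - \<i>) powi ?s)) * \<beta> j)"
      by (simp add: mult_ac)
    thus "a * ((- 1) ^ (j + 1) * coeff_b j k * \<beta> j) =
        - ((- 1) ^ j * (2 powi ?r - 2 powi ?s) * \<beta> j
        + u * ((- 1) ^ j * ((1 - \<i>) powi ?r - (1 - \<i>) powi ?s) * \<beta> j))"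
      by (simp add: algebra_simps)
  qed

  \<comment> \<open>After \<open>hecke\<close> the coefficient of L(q^2) is 4 u^2 - 2 u + 2 = 2 a +
    4, and L(q^4) collects -2 twice.\<close>
  have "a * \<zeta> = P * (a * S) - (2 * a + 4) * L (q ^ 2) + 4 * L (q ^ 4)"
  proof -
    have "P * (a * S) = - ((\<zeta> + 2 * L (q ^ 4)) - u ^ 2 * (\<zeta> + 2 * L q))
        - u * ((\<zeta> + 2 * L (q ^ 2)) - u * (\<zeta> + 2 * L (- q)))"
      unfolding S at_2 at_1_minus_ii by (simp add: algebra_simps)
    also have "\<dots> = (2 * u ^ 2 - u - 1) * \<zeta> - 2 * L (q ^ 4) - 2 * u * L (q ^ 2)
        + 2 * u ^ 2 * (L q + L (- q))"
      by (simp add: algebra_simps power2_eq_square)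
    finally show ?thesis
      unfolding hecke a_eq by (simp add: algebra_simps)
  qed
  hence "\<zeta> = P * S - (2 * a + 4) / a * L (q ^ 2) + 4 / a * L (q ^ 4)"
    using a by (simp add: field_simps)
  moreover have "q ^ 2 = of_real (exp (- 2 * pi))" "q ^ 4 = of_real (exp (- 4 * pi))"
    by (simp_all add: q_def flip: exp_of_nat_mult of_real_power)
  moreover have "S = (\<Sum>j = 0..k. (- 1) ^ (j + 1) * coeff_b j k * of_real (bernoulli (2 * j))
      * of_real (bernoulli (4 * k + 2 - 2 * j)) / (fact (2 * j) * fact (4 * k + 2 - 2 * j)))"
    unfolding S_def \<beta>_def atMost_atLeast0 by (simp add: mult.assoc)
  moreover have "\<zeta> = riemann_zeta (4 * of_nat k + 1)" "P = (2 * of_real pi) ^ (4 * k + 1)"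
    by (simp_all add: \<zeta>_def P_def p_def add.commute)
  moreover have "- of_nat p = (- 4 * of_nat k - 1 :: complex)"
    by (simp add: p_def)
  moreover have "(2 * a + 4) / a = of_real ((2 * coeff_a k + 4) / coeff_a k)"
    "4 / a = of_real (4 / coeff_a k)"
    by (simp_all add: a_def)
  ultimately show ?thesis
    by (simp only: L_def)
qed

end
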